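(* For every positive integer $k$, the ratio $\zeta(2k)/\pi^{2k}$ is a rational number.
   Context: For real $s>1$, $\zeta(s) := \sum_{n=1}^{\infty} 1/n^s$ is the Riemann zeta function. *)

theory Defs
  imports "HOL-Analysis.Analysis"
begin

text \<open>
  Only meaningful for \<open>s > 1\<close>. The summation index is shifted by one, so that the
  series starts at \<open>n = 1\<close>.
\<close>

definition zeta :: "real \<Rightarrow> real" where
  "zeta s = (\<Sum>n. 1 / real (Suc n) powr s)"

lemma zeta_sums:
  assumes "s > 1"
  shows "(\<lambda>n. 1 / real (Suc n) powr s) sums zeta s"
proof -
  have "summable (\<lambda>n. real n powr (- s))"
    using assms by (simp add: summable_real_powr_iff)
  then have "summable (\<lambda>n. real (Suc n) powr (- s))"
    by (subst summable_Suc_iff)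
  then have "summable (\<lambda>n. 1 / real (Suc n) powr s)"
    by (simp only: powr_minus_divide)
  then show ?thesis
    unfolding zeta_def by (rule summable_sums)
qed

end

theory Submission
  imports Defs
begin

text \<open>
  Write \<open>Z k = \<zeta>(2k)\<close>. The values \<open>Z k\<close> satisfy the classical quadratic recursion
  \<open>(\<Sum>j<m. Z (j + 1) * Z (m - j)) = (m + 3/2) * Z (m + 1)\<close> for \<open>m \<ge> 1\<close>, in which both factors on
  the left have smaller index than \<open>Z (m + 1)\<close>. Powers of \<open>\<pi>\<close> match on the two sides, so the
  rationality of \<open>Z k / \<pi>^(2k)\<close> propagates by strong induction from Euler's value
  \<open>Z 1 = \<pi>^2/6\<close>; this is the only place where \<open>\<pi>\<close> enters.

  The recursion is proved by multiplying out the truncated series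
  (\<open>sum_mult_even_power_sums\<close>). The left side becomes a sum over pairs \<open>a, b \<le> N\<close>. The diagonal
  \<open>a = b\<close> contributes \<open>m\<close> times the truncation of \<open>Z (m + 1)\<close>. Off the diagonal, the inner sum over
  \<open>j\<close> is geometric and equals \<open>(1/a^(2m) - 1/b^(2m)) / (b^2 - a^2)\<close>, so by antisymmetry everything
  reduces to \<open>\<Sum>b\<le>N. 1 / (b^2 - a^2)\<close>, which partial fractions turn into
  \<open>3/(4a^2)\<close> up to a difference of harmonic numbers (\<open>sum_inverse_diff_squares\<close>). These two
  contributions give the factor \<open>m + 3/2\<close>, and the total error vanishes in the limit because it is
  at most twice \<open>\<Sum>a\<le>N. 1 / (a * (N + 1 - a)) = 2 * harm N / (N + 1)\<close>.
\<close>

section \<open>Truncated even zeta values\<close>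

definition even_power_sum :: "nat \<Rightarrow> nat \<Rightarrow> real" where
  "even_power_sum k N = (\<Sum>a=1..N. (1 / real a ^ 2) ^ k)"

lemma even_power_sum_tendsto:
  assumes "k > 0"
  shows "even_power_sum k \<longlonglongrightarrow> zeta (real (2 * k))"
proof -
  have "(\<lambda>n. 1 / real (Suc n) powr real (2 * k)) sums zeta (real (2 * k))"
    using assms by (intro zeta_sums) simp
  moreover have "1 / real (Suc n) powr real (2 * k) = (1 / real (Suc n) ^ 2) ^ k" for n
    by (subst powr_realpow) (simp_all add: power_one_over power_mult del: of_nat_Suc)
  ultimately have "(\<lambda>n. (1 / real (Suc n) ^ 2) ^ k) sums zeta (real (2 * k))"
    by (simp only:)
  then show ?thesis
    unfolding sums_def even_power_sum_def
    by (simp only: One_nat_def sum.atLeast1_atMost_eq)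
qed

lemma zeta_2: "zeta 2 = pi\<^sup>2 / 6"
proof -
  have "(\<lambda>n. 1 / real (Suc n) powr 2) sums (pi\<^sup>2 / 6)"
    using inverse_squares_sums by (simp add: add.commute)
  then show ?thesis
    using sums_unique2[OF zeta_sums[of 2]] by simp
qed


section \<open>Harmonic numbers and the off-diagonal sum\<close>

lemma sum_inverse_shift: "(\<Sum>b=1..N. 1 / (real a + real b)) = harm (N + a) - harm a"
  by (induction N) (simp_all add: harm_Suc inverse_eq_divide add_ac)

text \<open>
  For \<open>b \<noteq> a\<close> the summand is \<open>(1/(b - a) - 1/(b + a)) / (2a)\<close>, so the sum telescopes into harmonic
  numbers; the term \<open>b = a\<close> is \<open>1/0 = 0\<close>. The constant \<open>3/(4a^2)\<close> collects the two defects
  \<open>1/a\<close> (from \<open>harm a - harm (a - 1)\<close>) and \<open>1/(2a)\<close> (from omitting \<open>b = a\<close> in the sum of the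
  \<open>1/(b + a)\<close>).
\<close>
lemma sum_inverse_diff_squares:
  assumes "a > 0" "a \<le> N"
  shows "(\<Sum>b=1..N. 1 / (real b ^ 2 - real a ^ 2)) =
           3 / 4 * (1 / real a ^ 2) - (harm (N + a) - harm (N - a)) / (2 * real a)"
  using \<open>a \<le> N\<close>
proof (induction N rule: dec_induct)
  case base
  obtain c where c: "a = Suc c"
    using assms(1) by (cases a) auto
  have split: "1 / (real b ^ 2 - real a ^ 2) =
      - (1 / (2 * real a)) * (1 / (real a - real b) + 1 / (real a + real b))"
    if "b \<in> {1..c}" for b
  proof -
    have nz: "real a - real b \<noteq> 0" "real a + real b \<noteq> 0" "real a \<noteq> 0"
      using that c by auto
    have "real b ^ 2 - real a ^ 2 = - ((real a - real b) * (real a + real b))"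
      by (simp add: power2_eq_square algebra_simps)
    moreover have "1 / (real a - real b) + 1 / (real a + real b) =
        2 * real a / ((real a - real b) * (real a + real b))"
      using nz by (simp add: add_frac_eq)
    ultimately show ?thesis using nz by simp
  qed
  have "(\<Sum>b=1..c. 1 / (real a - real b)) = (\<Sum>b=1..c. 1 / real b)"
    by (subst sum.atLeastAtMost_rev) (auto simp: c of_nat_diff intro!: sum.cong)
  then have reflected: "(\<Sum>b=1..c. 1 / (real a - real b)) = harm c"
    by (simp add: harm_def inverse_eq_divide)
  have "(\<Sum>b=1..a. 1 / (real b ^ 2 - real a ^ 2)) = (\<Sum>b=1..c. 1 / (real b ^ 2 - real a ^ 2))"
    by (simp add: c del: of_nat_Suc)
  also have "\<dots> = - (1 / (2 * real a)) *
      ((\<Sum>b=1..c. 1 / (real a - real b)) + (\<Sum>b=1..c. 1 / (real a + real b)))"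
    by (subst sum.distrib[symmetric], subst sum_distrib_left, rule sum.cong[OF refl split])
       simp_all
  also have "\<dots> = - (1 / (2 * real a)) * (harm c + (harm (c + a) - harm a))"
    by (simp only: reflected sum_inverse_shift)
  also have "harm (c + a) = harm (a + a) - 1 / (2 * real a)"
    by (simp add: c harm_Suc inverse_eq_divide)
  also have "harm a = harm c + 1 / real a"
    by (simp add: c harm_Suc inverse_eq_divide)
  also have "- (1 / (2 * real a)) *
        (harm c + (harm (a + a) - 1 / (2 * real a) - (harm c + 1 / real a))) =
      3 / 4 * (1 / real a ^ 2) - (harm (a + a) - harm (a - a)) / (2 * real a)"
    using assms(1) by (simp add: field_simps power2_eq_square harm_expand)
  finally show ?case .
next
  case (step N)
  have nz: "real (Suc N) - real a > 0" "real a > 0"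
    using step.hyps assms(1) by auto
  have "real (Suc N) ^ 2 - real a ^ 2 = (real (Suc N) - real a) * (real (Suc N) + real a)"
    by (simp add: power2_eq_square algebra_simps)
  then have "1 / (real (Suc N) ^ 2 - real a ^ 2) =
      (1 / (real (Suc N) - real a) - 1 / (real (Suc N) + real a)) / (2 * real a)"
    using nz by (simp add: diff_frac_eq del: of_nat_Suc)
  moreover have "harm (Suc N + a) = harm (N + a) + 1 / (real (Suc N) + real a)"
    by (simp add: harm_Suc inverse_eq_divide add_ac)
  moreover have "harm (Suc N - a) = harm (N - a) + 1 / (real (Suc N) - real a)"
    using step.hyps by (simp add: Suc_diff_le harm_Suc inverse_eq_divide of_nat_diff)
  ultimately show ?case
    using step.IH by (simp add: diff_divide_distrib add_divide_distrib del: of_nat_Suc)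
qed

lemma harm_diff_bounds:
  assumes "a > 0" "a \<le> N"
  shows "0 \<le> harm (N + a) - (harm (N - a) :: real)"
    and "harm (N + a) - harm (N - a) \<le> 2 * real a / real (N + 1 - a)"
proof -
  show "0 \<le> harm (N + a) - (harm (N - a) :: real)"
    by (simp add: harm_mono)
  have "harm (N + a) - harm (N - a) = (\<Sum>b=1..2*a. 1 / (real (N - a) + real b))"
    using sum_inverse_shift[of "N - a" "2 * a"] assms by (simp add: algebra_simps)
  also have "\<dots> \<le> (\<Sum>b=1..2*a. 1 / real (N + 1 - a))"
    using assms by (intro sum_mono divide_left_mono) (auto simp: of_nat_diff)
  finally show "harm (N + a) - harm (N - a) \<le> 2 * real a / real (N + 1 - a)"
    by simp
qed


section \<open>The recursion for even zeta values\<close>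

lemma geometric_sum_inverse_squares:
  fixes a b :: real
  assumes "a \<noteq> 0" "b \<noteq> 0" "a\<^sup>2 \<noteq> b\<^sup>2"
  shows "(\<Sum>j<m. (1 / a\<^sup>2) ^ (j + 1) * (1 / b\<^sup>2) ^ (m - j)) =
           ((1 / a\<^sup>2) ^ m - (1 / b\<^sup>2) ^ m) * (1 / (b\<^sup>2 - a\<^sup>2))"
proof -
  define x y where "x = 1 / a\<^sup>2" and "y = 1 / b\<^sup>2"
  have diff: "x ^ m - y ^ m = (x - y) * (\<Sum>i<m. y ^ (m - Suc i) * x ^ i)"
    by (rule power_diff_sumr2)
  have "x ^ (j + 1) * y ^ (m - j) = x * y * (y ^ (m - Suc j) * x ^ j)" if "j < m" for j
    using that by (simp add: Suc_diff_Suc[symmetric])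
  then have lhs: "(\<Sum>j<m. x ^ (j + 1) * y ^ (m - j)) = x * y * (\<Sum>i<m. y ^ (m - Suc i) * x ^ i)"
    unfolding sum_distrib_left by (intro sum.cong) auto
  have xy: "x * y = (x - y) * (1 / (b\<^sup>2 - a\<^sup>2))"
    using assms by (simp add: x_def y_def field_simps)
  show ?thesis
    unfolding x_def[symmetric] y_def[symmetric] lhs diff xy by (simp only: mult_ac)
qed

text \<open>
  In the sum over all pairs \<open>(a, b)\<close> the kernel \<open>c a b = 1 / (b^2 - a^2)\<close> is antisymmetric and, with
  \<open>1/0 = 0\<close>, vanishes on the diagonal. Hence the two halves of the off-diagonal part
  \<open>(1/a^(2m) - 1/b^(2m)) * c a b\<close> have the same sum.
\<close>
lemma sum_mult_even_power_sums:
  "(\<Sum>j<m. even_power_sum (j + 1) N * even_power_sum (m - j) N) =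
     (real m + 3 / 2) * even_power_sum (m + 1) N -
     (\<Sum>a=1..N. (1 / real a ^ 2) ^ m * ((harm (N + a) - harm (N - a)) / real a))"
proof -
  define x where "x a = 1 / real a ^ 2" for a
  define c where "c a b = 1 / (real b ^ 2 - real a ^ 2)" for a b
  have c_antisym: "c a b = - c b a" for a b
    unfolding c_def by (metis minus_diff_eq divide_minus_right)
  have pair: "(\<Sum>j<m. x a ^ (j + 1) * x b ^ (m - j)) =
      (x a ^ m * c a b + x b ^ m * c b a) + (if b = a then real m * x a ^ (m + 1) else 0)"
    if "a \<in> {1..N}" "b \<in> {1..N}" for a b
  proof (cases "b = a")
    case True
    have "x a ^ (j + 1) * x a ^ (m - j) = x a ^ (m + 1)" if "j < m" for j
      using that by (simp flip: power_add power_Suc)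
    then have "(\<Sum>j<m. x a ^ (j + 1) * x a ^ (m - j)) = (\<Sum>j<m. x a ^ (m + 1))"
      by (intro sum.cong) auto
    then show ?thesis
      by (simp add: True c_def)
  next
    case False
    have "(\<Sum>j<m. x a ^ (j + 1) * x b ^ (m - j)) = (x a ^ m - x b ^ m) * c a b"
      unfolding x_def c_def using that False
      by (intro geometric_sum_inverse_squares) auto
    then show ?thesis
      using False c_antisym[of b a] by (simp add: algebra_simps)
  qed
  have "(\<Sum>j<m. even_power_sum (j + 1) N * even_power_sum (m - j) N) =
      (\<Sum>j<m. \<Sum>a=1..N. \<Sum>b=1..N. x a ^ (j + 1) * x b ^ (m - j))"
    unfolding even_power_sum_def x_def by (simp only: sum_product)
  also have "\<dots> = (\<Sum>a=1..N. \<Sum>j<m. \<Sum>b=1..N. x a ^ (j + 1) * x b ^ (m - j))"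
    by (rule sum.swap)
  also have "\<dots> = (\<Sum>a=1..N. \<Sum>b=1..N. \<Sum>j<m. x a ^ (j + 1) * x b ^ (m - j))"
    by (intro sum.cong sum.swap refl)
  also have "\<dots> = (\<Sum>a=1..N. \<Sum>b=1..N. (x a ^ m * c a b + x b ^ m * c b a) +
      (if b = a then real m * x a ^ (m + 1) else 0))"
    by (intro sum.cong pair refl)
  also have "\<dots> = (\<Sum>a=1..N. \<Sum>b=1..N. x a ^ m * c a b) +
      (\<Sum>a=1..N. \<Sum>b=1..N. x b ^ m * c b a) + (\<Sum>a=1..N. real m * x a ^ (m + 1))"
    by (simp add: sum.distrib)
  also have "(\<Sum>a=1..N. \<Sum>b=1..N. x b ^ m * c b a) = (\<Sum>a=1..N. \<Sum>b=1..N. x a ^ m * c a b)"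
    by (rule sum.swap)
  also have "(\<Sum>a=1..N. \<Sum>b=1..N. x a ^ m * c a b) = (\<Sum>a=1..N. x a ^ m * (\<Sum>b=1..N. c a b))"
    by (simp only: sum_distrib_left)
  also have "\<dots> = (\<Sum>a=1..N. x a ^ m *
      (3 / 4 * x a - (harm (N + a) - harm (N - a)) / (2 * real a)))"
    unfolding c_def x_def by (intro sum.cong refl, subst sum_inverse_diff_squares) auto
  also have "\<dots> = (\<Sum>a=1..N. 3 / 4 * x a ^ (m + 1) -
      1 / 2 * (x a ^ m * ((harm (N + a) - harm (N - a)) / real a)))"
    by (intro sum.cong refl) (auto simp: field_simps)
  also have "\<dots> = 3 / 4 * even_power_sum (m + 1) N -
      1 / 2 * (\<Sum>a=1..N. x a ^ m * ((harm (N + a) - harm (N - a)) / real a))"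
    unfolding even_power_sum_def x_def by (simp only: sum_subtractf sum_distrib_left)
  also have "(\<Sum>a=1..N. real m * x a ^ (m + 1)) = real m * even_power_sum (m + 1) N"
    unfolding even_power_sum_def x_def by (simp only: sum_distrib_left)
  finally show ?thesis
    unfolding x_def by (simp add: algebra_simps)
qed

lemma sum_inverse_mult_reflect:
  "(\<Sum>a=1..N. 1 / (real a * real (N + 1 - a))) = 2 * harm N / real (N + 1)"
proof -
  have "(\<Sum>a=1..N. 1 / (real a * real (N + 1 - a))) =
      (\<Sum>a=1..N. (1 / real a + 1 / real (N + 1 - a)) / real (N + 1))"
    by (intro sum.cong refl) (auto simp: divide_simps of_nat_diff)
  also have "\<dots> = (harm N + (\<Sum>a=1..N. 1 / real (N + 1 - a))) / real (N + 1)"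
    by (simp add: harm_def inverse_eq_divide sum.distrib flip: sum_divide_distrib)
  also have "(\<Sum>a=1..N. 1 / real (N + 1 - a)) = harm N"
    unfolding harm_def inverse_eq_divide
    by (subst sum.atLeastAtMost_rev) (auto intro!: sum.cong)
  finally show ?thesis by simp
qed

lemma harm_over_n_tendsto_0: "(\<lambda>n. harm n / real n) \<longlonglongrightarrow> (0 :: real)"
proof (rule real_tendsto_sandwich[OF _ _ tendsto_const])
  show "(\<lambda>n. ln (real n) / real n + 1 / real n) \<longlonglongrightarrow> 0"
    using tendsto_add[OF lim_ln_over_n lim_1_over_n] by simp
  have "harm n / real n \<le> ln (real n) / real n + 1 / real n" if "n \<ge> 1" for n
  proof -
    have "harm n \<le> ln (real n) + 1"
      using euler_mascheroni_sequence_decreasing[of 1 n] that by (simp add: harm_def)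
    then show ?thesis
      by (simp add: divide_right_mono flip: add_divide_distrib)
  qed
  then show "\<forall>\<^sub>F n in sequentially. harm n / real n \<le> ln (real n) / real n + 1 / real n"
    using eventually_sequentially by blast
qed (simp_all add: harm_nonneg)

text \<open>
  For \<open>m = 0\<close> the sum would tend to \<open>3/2 * \<zeta>(2)\<close>, since the left side of the recursion is then
  empty. For \<open>m \<ge> 1\<close> one power of \<open>1/a\<close> is all that is needed: the difference of harmonic numbers
  is large only for \<open>a\<close> near \<open>N\<close>, where \<open>1/a\<close> is small.
\<close>
lemma error_tendsto_0:
  assumes "m > 0"
  shows "(\<lambda>N. \<Sum>a=1..N. (1 / real a ^ 2) ^ m * ((harm (N + a) - harm (N - a)) / real a))
           \<longlonglongrightarrow> 0"
proof (rule real_tendsto_sandwich[OF _ _ tendsto_const])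
  show "(\<lambda>N. 4 * (harm N / real N)) \<longlonglongrightarrow> 0"
    using tendsto_mult[OF tendsto_const harm_over_n_tendsto_0, of 4] by simp
  show "\<forall>\<^sub>F N in sequentially.
      0 \<le> (\<Sum>a=1..N. (1 / real a ^ 2) ^ m * ((harm (N + a) - harm (N - a)) / real a))"
    by (intro always_eventually allI sum_nonneg mult_nonneg_nonneg divide_nonneg_nonneg
        harm_diff_bounds(1)) auto
  have "(\<Sum>a=1..N. (1 / real a ^ 2) ^ m * ((harm (N + a) - harm (N - a)) / real a))
      \<le> 4 * (harm N / real N)" if "N > 0" for N
  proof -
    have "(\<Sum>a=1..N. (1 / real a ^ 2) ^ m * ((harm (N + a) - harm (N - a)) / real a))
        \<le> (\<Sum>a=1..N. 1 / real a * (2 / real (N + 1 - a)))"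
    proof (intro sum_mono mult_mono)
      fix a assume a: "a \<in> {1..N}"
      have le1: "1 / real a ^ 2 \<le> 1"
        using a by simp
      have "(1 / real a ^ 2) ^ m \<le> 1 / real a ^ 2"
        using power_decreasing[of 1 m "1 / real a ^ 2"] assms le1 by simp
      also have "\<dots> \<le> 1 / real a"
        using a by (intro divide_left_mono) (auto simp: power2_eq_square)
      finally show "(1 / real a ^ 2) ^ m \<le> 1 / real a" .
      have "(harm (N + a) - harm (N - a)) / real a \<le> 2 * real a / real (N + 1 - a) / real a"
        using a by (intro divide_right_mono harm_diff_bounds(2)) auto
      also have "\<dots> = 2 / real (N + 1 - a)"
        using a by simp
      finally show "(harm (N + a) - harm (N - a)) / real a \<le> 2 / real (N + 1 - a)" .
      show "0 \<le> (harm (N + a) - harm (N - a)) / real a"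
        using a harm_diff_bounds(1)[of a N] by simp
    qed simp
    also have "\<dots> = (\<Sum>a=1..N. 2 * (1 / (real a * real (N + 1 - a))))"
      by simp
    also have "\<dots> = 4 * (harm N / real (N + 1))"
      by (simp only: sum_inverse_mult_reflect flip: sum_distrib_left)
    also have "\<dots> \<le> 4 * (harm N / real N)"
      using that by (intro mult_left_mono divide_left_mono) (auto simp: harm_nonneg)
    finally show ?thesis .
  qed
  then show "\<forall>\<^sub>F N in sequentially.
      (\<Sum>a=1..N. (1 / real a ^ 2) ^ m * ((harm (N + a) - harm (N - a)) / real a))
        \<le> 4 * (harm N / real N)"
    by (intro eventually_mono[OF eventually_gt_at_top[of 0]])
qed

theorem zeta_even_recursion:
  assumes "m > 0"
  shows "(\<Sum>j<m. zeta (real (2 * (j + 1))) * zeta (real (2 * (m - j)))) =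
           (real m + 3 / 2) * zeta (real (2 * (m + 1)))"
proof (rule LIMSEQ_unique)
  show "(\<lambda>N. \<Sum>j<m. even_power_sum (j + 1) N * even_power_sum (m - j) N)
      \<longlonglongrightarrow> (\<Sum>j<m. zeta (real (2 * (j + 1))) * zeta (real (2 * (m - j))))"
    by (intro tendsto_sum tendsto_mult even_power_sum_tendsto) auto
  show "(\<lambda>N. \<Sum>j<m. even_power_sum (j + 1) N * even_power_sum (m - j) N)
      \<longlonglongrightarrow> (real m + 3 / 2) * zeta (real (2 * (m + 1)))"
    unfolding sum_mult_even_power_sums
    using tendsto_diff[OF tendsto_mult[OF tendsto_const even_power_sum_tendsto]
        error_tendsto_0[OF assms], of "m + 1" "real m + 3 / 2"] by simp
qed


section \<open>Rationality\<close>

theorem mainTheorem3: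
  fixes k :: nat
  assumes "k > 0"
  shows "zeta (real (2 * k)) / pi ^ (2 * k) \<in> \<rat>"
  using assms
proof (induction k rule: less_induct)
  case (less k)
  show ?case
  proof (cases "k = 1")
    case True
    then show ?thesis
      by (simp add: zeta_2)
  next
    case False
    define m where "m = k - 1"
    have m: "m > 0" "k = m + 1"
      using False less.prems by (auto simp: m_def)
    define q where "q i = zeta (real (2 * i)) / pi ^ (2 * i)" for i
    have zeta_q: "zeta (real (2 * i)) = q i * pi ^ (2 * i)" for i
      by (simp add: q_def)
    have "(\<Sum>j<m. q (j + 1) * q (m - j)) * pi ^ (2 * k) =
        (\<Sum>j<m. zeta (real (2 * (j + 1))) * zeta (real (2 * (m - j))))"
      unfolding sum_distrib_right
    proof (rule sum.cong)
      fix j assume "j \<in> {..<m}"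
      then have "2 * k = 2 * (j + 1) + 2 * (m - j)"
        using m by simp
      then show "q (j + 1) * q (m - j) * pi ^ (2 * k) =
          zeta (real (2 * (j + 1))) * zeta (real (2 * (m - j)))"
        by (simp only: zeta_q power_add) (simp only: mult_ac)
    qed simp
    also have "\<dots> = (real m + 3 / 2) * q k * pi ^ (2 * k)"
      using zeta_even_recursion[OF m(1)] by (simp only: m(2) zeta_q mult.assoc)
    finally have "(\<Sum>j<m. q (j + 1) * q (m - j)) = (real m + 3 / 2) * q k"
      by simp
    then have "q k = (\<Sum>j<m. q (j + 1) * q (m - j)) / (real m + 3 / 2)"
      by (simp only: eq_divide_eq) (simp add: mult.commute)
    moreover have "(\<Sum>j<m. q (j + 1) * q (m - j)) \<in> \<rat>"
      unfolding q_def using m(2) by (intro Rats_sum Rats_mult less.IH) auto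
    ultimately show ?thesis
      unfolding q_def[symmetric] by simp
  qed
qed

end
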